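(* Assume that $(\mathbf{A}_f,\mathbf{M}_f)$ is controllable. Then the full system $\dot{\mathbf{g}}=\mathbf{A}\mathbf{g}+\mathbf{B}\mathbf{w}+\mathbf{M}\mathbf{c}$ is output controllable with respect to the physical system part, i.e. with respect to the output $\mathbf{f}=\begin{pmatrix}\mathbf{I}&\mathbf{0}\end{pmatrix}\mathbf{g}$.
   Context: The controlled latent force model is $\dot{\mathbf{g}}(t)=\mathbf{A}\mathbf{g}(t)+\mathbf{B}\mathbf{w}(t)+\mathbf{M}\mathbf{c}(t)$ with $\mathbf{g}=(\mathbf{f},\mathbf{u})\in\mathbb{R}^{n_f}\times\mathbb{R}^{n_u}$, $$\mathbf{A}=\begin{pmatrix}\mathbf{A}_f&\mathbf{B}_f\mathbf{C}_u\\ \mathbf{0}&\mathbf{A}_u\end{pmatrix},\quad \mathbf{B}=\begin{pmatrix}\mathbf{0}\\ \mathbf{B}_u\end{pmatrix},\quad \mathbf{M}=\begin{pmatrix}\mathbf{M}_f\\ \mathbf{0}\end{pmatrix},$$ where all blocks are constant real matrices of compatible dimensions, $\mathbf{f}$ is the state of the physical system, $\mathbf{u}$ the state of the latent force, $\mathbf{w}$ white noise and $\mathbf{c}$ the control. Output controllability of $\dot{\mathbf{g}}=\mathbf{A}\mathbf{g}+\mathbf{M}\mathbf{c}$ with output $\mathbf{z}=\mathbf{H}\mathbf{g}$ means: for every initial state $\mathbf{g}(0)$ and every target output value $\mathbf{z}_1$ there are a finite time $t_1>0$ and a control $\mathbf{c}$ on $[0,t_1]$ with $\mathbf{H}\mathbf{g}(t_1)=\mathbf{z}_1$;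 equivalently, the matrix $\begin{pmatrix}\mathbf{H}\mathbf{M}&\mathbf{H}\mathbf{A}\mathbf{M}&\cdots&\mathbf{H}\mathbf{A}^{n-1}\mathbf{M}\end{pmatrix}$, $n=n_f+n_u$, has full row rank. *)

theory Defs
  imports "HOL-Analysis.Analysis"
begin

definition block_matrix ::
  "real^'a^'c \<Rightarrow> real^'b^'c \<Rightarrow> real^'a^'d \<Rightarrow> real^'b^'d \<Rightarrow> real^('a + 'b)^('c + 'd)"
  where "block_matrix P Q R S = (\<chi> i j.
    case i of
      Inl k \<Rightarrow> (case j of Inl l \<Rightarrow> P $ k $ l | Inr l \<Rightarrow> Q $ k $ l)
    | Inr k \<Rightarrow> (case j of Inl l \<Rightarrow> R $ k $ l | Inr l \<Rightarrow> S $ k $ l))"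

definition block_column :: "real^'a^'c \<Rightarrow> real^'a^'d \<Rightarrow> real^'a^('c + 'd)"
  where "block_column P Q = (\<chi> i. case i of Inl k \<Rightarrow> P $ k | Inr k \<Rightarrow> Q $ k)"

definition block_row :: "real^'a^'c \<Rightarrow> real^'b^'c \<Rightarrow> real^('a + 'b)^'c"
  where "block_row P Q = (\<chi> i j. case j of Inl l \<Rightarrow> P $ i $ l | Inr l \<Rightarrow> Q $ i $ l)"

(* Since controls are only assumed integrable, x' = A x + h on [0,T] is read in the
   Caratheodory sense, i.e. as the integral equation
   x(t) = x(0) + (integral of A x + h over [0,t]); it forces x to be continuous. *)
definition linear_ode_solution ::
  "real^'n^'n \<Rightarrow> (real \<Rightarrow> real^'n) \<Rightarrow> real \<Rightarrow> (real \<Rightarrow> real^'n) \<Rightarrow> bool"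
  where "linear_ode_solution A h T x \<longleftrightarrow>
    (\<forall>t\<in>{0..T}. ((\<lambda>s. A *v x s + h s) has_integral (x t - x 0)) {0..t})"

definition controllable :: "real^'n^'n \<Rightarrow> real^'m^'n \<Rightarrow> bool"
  where "controllable A M \<longleftrightarrow>
    (\<forall>x0 x1. \<exists>T>0. \<exists>c x.
       c absolutely_integrable_on {0..T} \<and>
       linear_ode_solution A (\<lambda>t. M *v c t) T x \<and>
       x 0 = x0 \<and> x T = x1)"

definition driven_solution ::
  "real^'n^'n \<Rightarrow> real^'w^'n \<Rightarrow> real^'m^'n \<Rightarrow> (real \<Rightarrow> real^'w) \<Rightarrow> (real \<Rightarrow> real^'m)
    \<Rightarrow> real \<Rightarrow> (real \<Rightarrow> real^'n) \<Rightarrow> bool"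
  where "driven_solution A B M w c T g \<longleftrightarrow>
    linear_ode_solution A (\<lambda>t. B *v w t + M *v c t) T g"

(* Output controllability of g' = A g + B w + M c with output H g is a property of the
   noise-free dynamics g' = A g + M c, so the white noise w is set to 0. *)
definition output_controllable ::
  "real^'n^'n \<Rightarrow> real^'w^'n \<Rightarrow> real^'m^'n \<Rightarrow> real^'n^'p \<Rightarrow> bool"
  where "output_controllable A B M H \<longleftrightarrow>
    (\<forall>g0 z1. \<exists>T>0. \<exists>c g.
       c absolutely_integrable_on {0..T} \<and>
       driven_solution A B M (\<lambda>t. 0) c T g \<and>
       g 0 = g0 \<and> H *v g T = z1)"

end

(* Because the final time in the definition of controllability may depend on the states, one first
   needs a uniform one: the states reachable from 0 in time T form a subspace that grows with T
   (idle at 0 first), and controllability says that these subspaces exhaust the finite-dimensional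
   state space, so one of them is already everything. For that T, let y be the free motion of the
   full system from g0 and steer the physical part from 0 to z1 - f(y(T)); since the control
   does not act on the latent force, superposing both motions gives the required trajectory. *)

theory Submission
  imports Defs
begin

section \<open>Solutions of linear systems: free motion, superposition, linear images\<close>

text \<open>The free motion is exp(tA) v. Each component is built as a real power series, so that
  termwise differentiation of real series applies; it solves the equation on the whole line, hence
  for every \<open>T\<close>.\<close>

lemma free_solution_exists:
  fixes A :: "real^'n^'n"
  shows "\<exists>y. y 0 = v \<and> linear_ode_solution A (\<lambda>t. 0) T y"
proof -
  define a where "a k = ((*v) A ^^ k) v" for k :: nat
  obtain K where K: "K > 0" "\<And>x. norm (A *v x) \<le> norm x * K"
    using bounded_linear.pos_bounded[OF matrix_vector_mul_bounded_linear[of A]] by blast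
  have norm_a: "norm (a k) \<le> K ^ k * norm v" for k
  proof (induction k)
    case (Suc k)
    have "norm (a (Suc k)) \<le> norm (a k) * K"
      using K(2)[of "a k"] by (simp add: a_def)
    also have "\<dots> \<le> (K ^ k * norm v) * K"
      using Suc K(1) by (intro mult_right_mono) auto
    finally show ?case by (simp add: mult_ac)
  qed (simp add: a_def)
  \<comment> \<open>\<open>c i k\<close> is the coefficient of t^k in component \<open>i\<close> of
    exp(tA) v.\<close>
  define c where "c i k = a k $ i / fact k" for i k
  \<comment> \<open>The bound \<open>norm_a\<close> makes the exponential series of
    \<open>K * \<bar>t\<bar>\<close>, scaled by \<open>norm v\<close>, a majorant.\<close>
  have summable_c: "summable (\<lambda>k. c i k * t ^ k)" for i t
  proof (rule summable_comparison_test', rule summable_mult2, rule summable_exp)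
    fix k :: nat
    have "\<bar>a k $ i\<bar> \<le> K ^ k * norm v"
      using component_le_norm_cart[of "a k" i] norm_a[of k] by linarith
    then have "\<bar>a k $ i\<bar> * \<bar>t\<bar> ^ k / fact k \<le> (K ^ k * norm v) * \<bar>t\<bar> ^ k / fact k"
      by (intro divide_right_mono mult_right_mono) auto
    then show "norm (c i k * t ^ k) \<le> inverse (fact k) * (K * \<bar>t\<bar>) ^ k * norm v"
      by (simp add: c_def abs_mult power_abs field_simps)
  qed
  define y where "y t = (\<chi> i. \<Sum>k. c i k * t ^ k)" for t
  \<comment> \<open>This is y' = A y on the level of coefficients: differentiating turns A^(k+1) v /
    (k+1)! into A (A^k v / k!), because the factor k+1 cancels.\<close>
  have diffs_c: "diffs (c i) k = (\<Sum>j\<in>UNIV. A $ i $ j * c j k)" for i k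
  proof -
    have "diffs (c i) k = a (Suc k) $ i / fact k"
      by (simp add: diffs_def c_def field_simps del: of_nat_Suc)
    also have "a (Suc k) $ i = (\<Sum>j\<in>UNIV. A $ i $ j * a k $ j)"
      by (simp add: a_def matrix_vector_mult_def)
    also have "(\<Sum>j\<in>UNIV. A $ i $ j * a k $ j) / fact k = (\<Sum>j\<in>UNIV. A $ i $ j * c j k)"
      by (simp add: c_def sum_divide_distrib)
    finally show ?thesis .
  qed
  have "((\<lambda>t. y t $ i) has_vector_derivative (A *v y t) $ i) (at t)" for i t
  proof -
    have "((\<lambda>t. \<Sum>k. c i k * t ^ k) has_field_derivative (\<Sum>k. diffs (c i) k * t ^ k)) (at t)"
      by (rule termdiffs_strong_converges_everywhere) (rule summable_c)
    also have "(\<Sum>k. diffs (c i) k * t ^ k) = (\<Sum>k. \<Sum>j\<in>UNIV. A $ i $ j * (c j k * t ^ k))"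
      by (simp add: diffs_c sum_distrib_right mult.assoc)
    also have "\<dots> = (\<Sum>j\<in>UNIV. \<Sum>k. A $ i $ j * (c j k * t ^ k))"
      by (intro suminf_sum summable_mult summable_c)
    also have "\<dots> = (A *v y t) $ i"
      by (simp add: y_def matrix_vector_mult_def suminf_mult summable_c)
    finally show ?thesis
      by (simp add: y_def has_real_derivative_iff_has_vector_derivative)
  qed
  then have deriv: "(y has_vector_derivative A *v y t) (at t)" for t
    unfolding has_vector_derivative_def has_derivative_componentwise_within[of y]
    by (auto simp: Basis_vec_def inner_axis)
  have "y 0 = v"
  proof -
    have "(\<Sum>k. c i k * 0 ^ k) = c i 0" for i
      by (rule powser_zero)
    then show ?thesis by (simp add: y_def c_def a_def vec_eq_iff)
  qed
  moreover have "linear_ode_solution A (\<lambda>t. 0) T y"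
    unfolding linear_ode_solution_def
    using deriv[THEN has_vector_derivative_at_within]
    by (auto intro!: fundamental_theorem_of_calculus)
  ultimately show ?thesis by blast
qed

lemma linear_ode_solution_add:
  assumes "linear_ode_solution A h T x" and "linear_ode_solution A k T y"
  shows "linear_ode_solution A (\<lambda>t. h t + k t) T (\<lambda>t. x t + y t)"
  unfolding linear_ode_solution_def
proof
  fix t assume "t \<in> {0..T}"
  then have "((\<lambda>s. (A *v x s + h s) + (A *v y s + k s)) has_integral
      (x t - x 0) + (y t - y 0)) {0..t}"
    using assms unfolding linear_ode_solution_def by (intro has_integral_add) auto
  then show "((\<lambda>s. A *v (x s + y s) + (h s + k s)) has_integral
      (x t + y t) - (x 0 + y 0)) {0..t}"
    by (simp add: matrix_vector_right_distrib algebra_simps)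
qed

text \<open>A linear map commutes with the integral, and the intertwining relation rewrites E A' x
  as A E x inside it.\<close>

lemma linear_ode_solution_matrix_image:
  fixes A :: "real^'n^'n" and A' :: "real^'k^'k" and E :: "real^'k^'n"
  assumes "linear_ode_solution A' h T x" and intertwine: "A ** E = E ** A'"
  shows "linear_ode_solution A (\<lambda>t. E *v h t) T (\<lambda>t. E *v x t)"
  unfolding linear_ode_solution_def
proof
  fix t assume "t \<in> {0..T}"
  then have "((\<lambda>s. A' *v x s + h s) has_integral x t - x 0) {0..t}"
    using assms(1) unfolding linear_ode_solution_def by blast
  from has_integral_linear[OF this matrix_vector_mul_bounded_linear[of E]]
  have "((\<lambda>s. E *v (A' *v x s + h s)) has_integral E *v (x t - x 0)) {0..t}"
    by (simp only: o_def)
  then show "((\<lambda>s. A *v (E *v x s) + E *v h s) has_integral E *v x t - E *v x 0) {0..t}"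
    by (simp add: matrix_vector_right_distrib matrix_vector_mult_diff_distrib
        matrix_vector_mul_assoc intertwine)
qed

section \<open>Reachable sets from the origin and a uniform time\<close>

text \<open>Starting at 0 makes the set closed under superposition and lets a trajectory idle before
  it moves. The time is a parameter so that different horizons can be compared.\<close>

definition reachable :: "real^'n^'n \<Rightarrow> real^'m^'n \<Rightarrow> real \<Rightarrow> (real^'n) set"
  where "reachable A M T = {z. \<exists>c x. c absolutely_integrable_on {0..T} \<and>
    linear_ode_solution A (\<lambda>t. M *v c t) T x \<and> x 0 = 0 \<and> x T = z}"

lemma subspace_reachable: "subspace (reachable A M T)"
proof (rule subspaceI)
  have "linear_ode_solution A (\<lambda>t. M *v 0) T (\<lambda>t. 0)"
    by (simp add: linear_ode_solution_def)
  then show "0 \<in> reachable A M T"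
    unfolding reachable_def by (intro CollectI exI[of _ "\<lambda>t. 0"]) auto
next
  fix z z' assume "z \<in> reachable A M T" "z' \<in> reachable A M T"
  then obtain c x c' x'
    where c: "c absolutely_integrable_on {0..T}" "c' absolutely_integrable_on {0..T}"
      and x: "linear_ode_solution A (\<lambda>t. M *v c t) T x" "x 0 = 0" "x T = z"
      and x': "linear_ode_solution A (\<lambda>t. M *v c' t) T x'" "x' 0 = 0" "x' T = z'"
    unfolding reachable_def by blast
  have "linear_ode_solution A (\<lambda>t. M *v (c t + c' t)) T (\<lambda>t. x t + x' t)"
    using linear_ode_solution_add[OF x(1) x'(1)] by (simp add: matrix_vector_right_distrib)
  then show "z + z' \<in> reachable A M T"
    using c x x' unfolding reachable_def
    by (intro CollectI exI[of _ "\<lambda>t. c t + c' t"] exI[of _ "\<lambda>t. x t + x' t"]) auto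
next
  fix r z assume "z \<in> reachable A M T"
  then obtain c x where c: "c absolutely_integrable_on {0..T}"
      and x: "linear_ode_solution A (\<lambda>t. M *v c t) T x" "x 0 = 0" "x T = z"
    unfolding reachable_def by blast
  have "linear_ode_solution A (\<lambda>t. M *v (r *\<^sub>R c t)) T (\<lambda>t. r *\<^sub>R x t)"
    unfolding linear_ode_solution_def
  proof
    fix t assume "t \<in> {0..T}"
    then have "((\<lambda>s. r *\<^sub>R (A *v x s + M *v c s)) has_integral r *\<^sub>R (x t - x 0)) {0..t}"
      using x(1) unfolding linear_ode_solution_def by (intro has_integral_cmul) auto
    then show "((\<lambda>s. A *v (r *\<^sub>R x s) + M *v (r *\<^sub>R c s)) has_integral
        r *\<^sub>R x t - r *\<^sub>R x 0) {0..t}"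
      by (simp add: matrix_vector_mult_scaleR scaleR_right_distrib scaleR_right_diff_distrib)
  qed
  moreover have "(\<lambda>t. r *\<^sub>R c t) absolutely_integrable_on {0..T}"
    using c by (rule absolutely_integrable_scaleR_left)
  ultimately show "r *\<^sub>R z \<in> reachable A M T"
    using x unfolding reachable_def
    by (intro CollectI exI[of _ "\<lambda>t. r *\<^sub>R c t"] exI[of _ "\<lambda>t. r *\<^sub>R x t"]) auto
qed

lemma has_integral_shift:
  fixes f :: "real \<Rightarrow> 'a::euclidean_space"
  assumes "(f has_integral I) {0..b}"
  shows "((\<lambda>s. f (s - d)) has_integral I) {d..d + b}"
  using has_integral_shift_Icc_real[of f "-d" I d "d + b"] assms by (simp add: o_def)

lemma reachable_mono:
  fixes A :: "real^'n^'n" and M :: "real^'m^'n"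
  assumes "0 \<le> S" "S \<le> T"
  shows "reachable A M S \<subseteq> reachable A M T"
proof
  fix z assume "z \<in> reachable A M S"
  then obtain c x where c: "c absolutely_integrable_on {0..S}"
      and x: "linear_ode_solution A (\<lambda>t. M *v c t) S x" "x 0 = 0" "x S = z"
    unfolding reachable_def by blast
  define d where "d = T - S"
  define c' where "c' t = (if t \<in> {d..T} then c (t - d) else 0)" for t
  \<comment> \<open>At the switching time \<open>d\<close> the delayed trajectory starts from
    \<open>x 0 = 0\<close>, so it joins the idle phase without a jump.\<close>
  define x' where "x' t = (if t \<in> {d..T} then x (t - d) else 0)" for t
  have T: "T = d + S" and d: "d \<ge> 0" using assms by (auto simp: d_def)
  have "linear_ode_solution A (\<lambda>t. M *v c' t) T x'"
    unfolding linear_ode_solution_def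
  proof
    fix t assume t: "t \<in> {0..T}"
    have x'0: "x' 0 = 0" using d x(2) by (auto simp: x'_def)
    show "((\<lambda>s. A *v x' s + M *v c' s) has_integral (x' t - x' 0)) {0..t}"
    proof (cases "t < d")
      case True
      have "((\<lambda>s. A *v x' s + M *v c' s) has_integral 0) {0..t}"
        by (rule has_integral_is_0) (use True in \<open>auto simp: x'_def c'_def\<close>)
      then show ?thesis using True x'0 by (simp add: x'_def)
    next
      case False
      have "((\<lambda>s. A *v x s + M *v c s) has_integral x (t - d)) {0..t - d}"
        using x(1,2) t False T unfolding linear_ode_solution_def by force
      then have "((\<lambda>s. A *v x (s - d) + M *v c (s - d)) has_integral x (t - d)) {d..t}"
        using has_integral_shift[of _ _ "t - d" d] by force
      \<comment> \<open>Extending the integrand by zero to the idle phase leaves the integral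
        unchanged and gives exactly the right-hand side belonging to \<open>x'\<close> and
        \<open>c'\<close>.\<close>
      then have "((\<lambda>s. if s \<in> {d..t} then A *v x (s - d) + M *v c (s - d) else 0)
          has_integral x (t - d)) {0..t}"
        using d by (subst has_integral_restrict) auto
      then have "((\<lambda>s. A *v x' s + M *v c' s) has_integral x (t - d)) {0..t}"
        by (rule has_integral_eq[rotated]) (use t in \<open>auto simp: x'_def c'_def\<close>)
      then show ?thesis using False t x'0 by (simp add: x'_def)
    qed
  qed
  moreover have "c' absolutely_integrable_on {0..T}"
  proof -
    \<comment> \<open>Absolute integrability is checked as integrability of the control and of its
      norm; the type of \<open>f\<close> is left general to cover both.\<close>
    have shift: "(\<lambda>t. f (t - d)) integrable_on {d..T}" if "f integrable_on {0..S}"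
      for f :: "real \<Rightarrow> 'b::euclidean_space"
      using that unfolding T by (auto simp: integrable_on_def dest: has_integral_shift)
    have sub: "{d..T} \<inter> {0..T} = {d..T}"
      using d by auto
    have "(\<lambda>t. if t \<in> {d..T} then c (t - d) else 0) integrable_on {0..T}"
      using c shift[of c]
      by (simp only: integrable_restrict_Int sub absolutely_integrable_on_def)
    moreover have "(\<lambda>t. if t \<in> {d..T} then norm (c (t - d)) else 0) integrable_on {0..T}"
      using c shift[of "\<lambda>t. norm (c t)"]
      by (simp only: integrable_restrict_Int sub absolutely_integrable_on_def)
    moreover have "norm (c' t) = (if t \<in> {d..T} then norm (c (t - d)) else 0)" for t
      by (simp add: c'_def)
    ultimately show ?thesis
      by (simp add: absolutely_integrable_on_def c'_def[abs_def] cong: if_cong)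
  qed
  moreover have "x' 0 = 0" "x' T = z"
    using d x assms by (auto simp: x'_def d_def)
  ultimately show "z \<in> reachable A M T"
    unfolding reachable_def by blast
qed

text \<open>Only finitely many targets matter: the largest of the times for the standard basis
  vectors serves all of them by monotonicity, and then their span because the reachable set is a
  subspace.\<close>

lemma controllable_imp_reachable_UNIV:
  assumes "controllable A M"
  shows "\<exists>T>0. reachable A M T = UNIV"
proof -
  have "\<forall>b. \<exists>T>0. b \<in> reachable A M T"
    using assms unfolding controllable_def reachable_def by blast
  then obtain S where S: "\<And>b. S b > 0" "\<And>b. b \<in> reachable A M (S b)"
    by metis
  define T where "T = Max (S ` Basis)"
  have le: "S b \<le> T" if "b \<in> Basis" for b
    using that by (simp add: T_def)
  have "Basis \<subseteq> reachable A M T"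
    using reachable_mono[of "S b" T for b] S le by (metis less_imp_le subset_iff)
  then have "span Basis \<subseteq> reachable A M T"
    using subspace_reachable by (rule span_minimal)
  moreover have "T > 0"
    using le[OF SOME_Basis] S(1) less_le_trans by blast
  ultimately show ?thesis by auto
qed

section \<open>Reduction to an invariant subsystem\<close>

text \<open>The intertwining conditions say that the range of \<open>E\<close> is an invariant subsystem
  \<open>(A', M')\<close> through which alone the control acts and which the output \<open>H\<close> reads off.\<close>

lemma output_controllable_via_subsystem:
  fixes A :: "real^'n^'n" and A' :: "real^'k^'k" and E :: "real^'k^'n"
    and B :: "real^'w^'n" and M' :: "real^'m^'k"
  assumes "controllable A' M'"
    and "A ** E = E ** A'" and "M = E ** M'" and "H ** E = mat 1"
  shows "output_controllable A B M H"
  unfolding output_controllable_def driven_solution_def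
proof (intro allI)
  fix g0 z1
  \<comment> \<open>The time has to be fixed before the target: the state to be reached below
    depends on \<open>y T\<close>, while controllability alone would choose a time depending on that
    state.\<close>
  obtain T where T: "T > 0" "reachable A' M' T = UNIV"
    using controllable_imp_reachable_UNIV[OF assms(1)] by blast
  obtain y where y: "y 0 = g0" "linear_ode_solution A (\<lambda>t. 0) T y"
    using free_solution_exists by blast
  \<comment> \<open>The subsystem has to supply what the free motion misses at time
    \<open>T\<close>; as H E = 1, its state enters the output unchanged.\<close>
  have "z1 - H *v y T \<in> reachable A' M' T"
    using T(2) by simp
  then obtain c x where c: "c absolutely_integrable_on {0..T}"
      and x: "linear_ode_solution A' (\<lambda>t. M' *v c t) T x" "x 0 = 0" "x T = z1 - H *v y T"
    unfolding reachable_def by blast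
  have "linear_ode_solution A (\<lambda>t. B *v 0 + M *v c t) T (\<lambda>t. y t + E *v x t)"
    using linear_ode_solution_add[OF y(2) linear_ode_solution_matrix_image[OF x(1) assms(2)]]
    by (simp add: assms(3) matrix_vector_mul_assoc)
  moreover have "H *v (y T + E *v x T) = z1"
    by (simp add: x(3) matrix_vector_right_distrib matrix_vector_mul_assoc assms(4))
  ultimately show "\<exists>T>0. \<exists>c g. c absolutely_integrable_on {0..T} \<and>
      linear_ode_solution A (\<lambda>t. B *v 0 + M *v c t) T g \<and> g 0 = g0 \<and> H *v g T = z1"
    using T(1) c x(2) y(1)
    by (intro exI[of _ T] conjI exI[of _ c] exI[of _ "\<lambda>t. y t + E *v x t"]) auto
qed

section \<open>Block matrix algebra and the latent force model\<close>

lemma sum_UNIV_Plus: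
  fixes f :: "'a::finite + 'b::finite \<Rightarrow> 'c::comm_monoid_add"
  shows "(\<Sum>j\<in>UNIV. f j) = (\<Sum>j\<in>UNIV. f (Inl j)) + (\<Sum>j\<in>UNIV. f (Inr j))"
  unfolding UNIV_Plus_UNIV[symmetric] by (subst sum.Plus) (simp_all add: o_def)

lemma block_matrix_mult_block_column:
  "block_matrix P Q R S ** block_column X Y = block_column (P ** X + Q ** Y) (R ** X + S ** Y)"
  by (auto simp: vec_eq_iff matrix_matrix_mult_def block_matrix_def block_column_def sum_UNIV_Plus
      split: sum.split)

lemma block_row_mult_block_column:
  "block_row P Q ** block_column X Y = P ** X + Q ** Y"
  by (auto simp: vec_eq_iff matrix_matrix_mult_def block_row_def block_column_def sum_UNIV_Plus)

lemma block_column_mult: "block_column X Y ** Z = block_column (X ** Z) (Y ** Z)"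
  by (auto simp: vec_eq_iff matrix_matrix_mult_def block_column_def split: sum.split)

theorem mainTheorem6:
  fixes A\<^sub>f :: "real^'nf^'nf" and B\<^sub>f :: "real^'q^'nf" and M\<^sub>f :: "real^'m^'nf"
    and A\<^sub>u :: "real^'nu^'nu" and B\<^sub>u :: "real^'w^'nu" and C\<^sub>u :: "real^'nu^'q"
    and A :: "real^('nf + 'nu)^('nf + 'nu)"
    and B :: "real^'w^('nf + 'nu)"
    and M :: "real^'m^('nf + 'nu)"
  assumes "A = block_matrix A\<^sub>f (B\<^sub>f ** C\<^sub>u) 0 A\<^sub>u"
    and "B = block_column 0 B\<^sub>u"
    and "M = block_column M\<^sub>f 0"
    and "controllable A\<^sub>f M\<^sub>f"
  shows "output_controllable A B M (block_row (mat 1) 0)"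
proof (rule output_controllable_via_subsystem[OF assms(4)])
  \<comment> \<open>\<open>?E\<close> embeds a physical state f as (f, 0). This subspace is
    invariant because the lower left block of \<open>A\<close> is 0, and the control stays inside it
    because the lower block of \<open>M\<close> is 0.\<close>
  let ?E = "block_column (mat 1) 0 :: real^'nf^('nf + 'nu)"
  show "A ** ?E = ?E ** A\<^sub>f" "M = ?E ** M\<^sub>f" "block_row (mat 1) 0 ** ?E = mat 1"
    by (simp_all add: assms(1,3) block_matrix_mult_block_column block_row_mult_block_column
        block_column_mult)
qed

end
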